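(* Let $\kappa>\omega_1$ be regular, and let $\vec{S}=\langle S_{\alpha,i}\mid\alpha<\kappa,\ i<\omega_1\rangle$ be a sequence of subsets of $S^\kappa_\omega$, each stationary in $\kappa$. Let $\mathcal{S}=\{\mathsf{lift}(S_{\alpha,i},[H_\kappa]^\omega)\mid\alpha<\kappa,\ i<\omega_1\}$. Then the exact diagonal strong reflection principle $\mathsf{eDSRP}(\mathcal{S})$ implies the existence of an exact diagonal reflection point for $\vec{S}$.
   Context: $[Y]^\omega$ denotes the set of countable subsets of $Y$, and $S^\kappa_\omega=\{\alpha<\kappa\mid\mathrm{cf}(\alpha)=\omega\}$. For $A\subseteq\kappa$ unbounded, $\mathsf{lift}(A,[H_\kappa]^\omega)=\{x\in[H_\kappa]^\omega\mid\sup(x\cap\kappa)\in A\}$. Let $\mathcal{S}$ be a collection of stationary subsets of $[H_\kappa]^\omega$ and $X$ a set. A sequence $\vec{Q}=\langle Q_i\mid i<\omega_1\rangle$ is an exact diagonal chain through $\mathcal{S}$ up to $X$ if: (1) $\vec{Q}$ is a continuous $\in$-chain of countable subsets of $H_\kappa$: $Q_i\in Q_{i+1}$ for all $i<\omega_1$, and $Q_\lambda=\bigcup_{i<\lambda}Q_i$ for limit $\lambda<\omega_1$; (2) for every $S\in X\cap\mathcal{S}$, the set $\{i<\omega_1\mid Q_i\in S\}$ is stationary in $\omega_1$; (3) $H_\kappa\cap X=\bigcup_{i<\omega_1}Q_i$, and $\langle Q_i\mid i<\alpha\rangle\in H_\kappa\cap X$ for all $\alpha<\omega_1$; (4) for every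 $i<\omega_1$, $Q_i\in\bigcup(X\cap\mathcal{S})$. $\mathsf{eDSRP}(\mathcal{S})$ says that for a sufficiently large regular $\theta$ (so that $\mathcal{S}\subseteq H_\theta$, i.e. $\theta>2^{<\kappa}$), the set of $X\in[H_\theta]^{\omega_1}$ such that $\omega_1\subseteq X$ and there is an exact diagonal chain through $\mathcal{S}$ up to $X$ is stationary in $H_\theta$ (i.e., for every $F:[H_\theta]^{<\omega}\to H_\theta$ it has a member closed under $F$). Reflection points: for $A\subseteq\kappa$ stationary in $\kappa$, an ordinal $\rho<\kappa$ of uncountable cofinality is a reflection point of $A$ if $A\cap\rho$ is stationary in $\rho$. For a collection $\mathcal{A}$ of stationary subsets of $\kappa$, $\rho$ is an exact simultaneous reflection point of $\mathcal{A}$ if $\rho$ is a reflection point of every $A\in\mathcal{A}$ and $(\bigcup\mathcal{A})\cap\rho$ contains a club in $\rho$. An ordinal $\rho<\kappa$ of uncountable cofinality is an exact diagonal reflection point of $\vec{S}$ if there is a set $R\subseteq\rho$ such that $R$ has cardinality $\omega_1$, $R$ contains a club in $\rho$, and $\rho$ is an exact simultaneous reflection point of $\{S_{\alpha,i}\mid\alpha\in R,\ i<\omega_1\}$. *)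

theory Defs
  imports "HOL-Library.Equipollence" "HOL-Library.Countable_Set" "HOL-Library.Nat_Bijection"
begin

section \<open>A universe of hereditarily bounded sets\<close>

text \<open>
  For every type \<open>'k\<close> we construct the universe \<open>'k V\<close> of all pure well-founded sets that are
  hereditarily of cardinality at most \<open>\<mu>\<close>, where \<open>\<mu>\<close> is the cardinality of the type
  \<open>nat set + 'k\<close> (the summand \<open>nat set\<close> makes sure that the universe has the set of all countable
  ordinals as an element). So \<open>'k V\<close> is the transitive set $H_{\mu^+}$. The type parameter is
  arbitrary: a statement for all types \<open>'k\<close> covers arbitrarily large universes. An element
  of the universe is a well-founded tree modulo bisimilarity.
\<close>

datatype 'b wtree = Node "'b \<Rightarrow> 'b wtree option"

inductive bisim :: "'b wtree \<Rightarrow> 'b wtree \<Rightarrow> bool" where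
  "(\<forall>s\<in>ran f. \<exists>t\<in>ran g. bisim s t) \<Longrightarrow> (\<forall>t\<in>ran g. \<exists>s\<in>ran f. bisim s t) \<Longrightarrow>
    bisim (Node f) (Node g)"

lemma bisim_Node:
  "bisim (Node f) (Node g) \<longleftrightarrow>
    (\<forall>s\<in>ran f. \<exists>t\<in>ran g. bisim s t) \<and> (\<forall>t\<in>ran g. \<exists>s\<in>ran f. bisim s t)"
  by (simp add: bisim.simps[of "Node f" "Node g"])

lemma wtree_induct: "(\<And>f. (\<And>t. t \<in> ran f \<Longrightarrow> P t) \<Longrightarrow> P (Node f)) \<Longrightarrow> P t"
proof (induction t)
  case (Node f)
  have "P t" if "t \<in> ran f" for t
  proof -
    from that obtain i where "f i = Some t" by (auto simp: ran_def)
    then have "t \<in> set_option (f i)" by simp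
    moreover have "f i \<in> range f" by (rule rangeI)
    ultimately show ?thesis using Node(1) Node(2) by blast
  qed
  then show ?case by (rule Node(2))
qed

lemma bisim_refl: "bisim t t"
proof (induction t rule: wtree_induct)
  case (1 f)
  then show ?case unfolding bisim_Node by blast
qed

lemma bisim_sym: "bisim s t \<Longrightarrow> bisim t s"
proof (induction s arbitrary: t rule: wtree_induct)
  case (1 f)
  obtain g where t: "t = Node g" by (cases t)
  have "bisim (Node f) (Node g)" using 1(2) t by simp
  then show ?case unfolding t bisim_Node using 1(1) by blast
qed

lemma bisim_trans: "bisim s t \<Longrightarrow> bisim t u \<Longrightarrow> bisim s u"
proof (induction s arbitrary: t u rule: wtree_induct)
  case (1 f)
  obtain g h where tu: "t = Node g" "u = Node h" by (metis wtree.exhaust)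
  have fg: "bisim (Node f) (Node g)" and gh: "bisim (Node g) (Node h)" using 1(2,3) tu by simp_all
  show ?case unfolding tu bisim_Node
  proof (intro conjI ballI)
    fix r assume r: "r \<in> ran f"
    then obtain s where s: "s \<in> ran g" "bisim r s" using fg unfolding bisim_Node by blast
    then obtain t where "t \<in> ran h" "bisim s t" using gh unfolding bisim_Node by blast
    then show "\<exists>t\<in>ran h. bisim r t" using 1(1)[OF r s(2)] by blast
  next
    fix t assume t: "t \<in> ran h"
    then obtain s where s: "s \<in> ran g" "bisim s t" using gh unfolding bisim_Node by blast
    then obtain r where "r \<in> ran f" "bisim r s" using fg unfolding bisim_Node by blast
    then show "\<exists>r\<in>ran f. bisim r t" using 1(1) s(2) by blast
  qed
qed

lemma equivp_bisim: "equivp (bisim :: 'b wtree \<Rightarrow> _)"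
proof (intro equivpI reflpI sympI transpI)
  fix s t u :: "'b wtree"
  show "bisim s s" by (rule bisim_refl)
  show "bisim s t \<Longrightarrow> bisim t s" by (rule bisim_sym)
  show "bisim s t \<Longrightarrow> bisim t u \<Longrightarrow> bisim s u" by (rule bisim_trans)
qed

quotient_type 'k V = "(nat set + 'k) wtree" / bisim
  by (rule equivp_bisim)

definition elts :: "'k V \<Rightarrow> 'k V set" where
  "elts x = {y. \<exists>f. x = abs_V (Node f) \<and> y \<in> abs_V ` ran f}"

definition small :: "'k V set \<Rightarrow> bool" where
  "small A \<longleftrightarrow> A \<lesssim> (UNIV :: (nat set + 'k) set)"

text \<open>The set with the given elements; meaningful for small arguments only.\<close>

definition vset :: "'k V set \<Rightarrow> 'k V" where
  "vset A = (SOME x. elts x = A)"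

lemma abs_V_eq_iff: "abs_V s = abs_V t \<longleftrightarrow> bisim s t"
  using Quotient3_rel[OF Quotient3_V, of s t] by (simp add: bisim_refl)

lemma bisim_Node_iff: "bisim (Node f) (Node g) \<longleftrightarrow> abs_V ` ran f = abs_V ` ran g"
proof -
  have "abs_V ` ran f = abs_V ` ran g \<longleftrightarrow>
      (\<forall>s\<in>ran f. \<exists>t\<in>ran g. abs_V s = abs_V t) \<and> (\<forall>t\<in>ran g. \<exists>s\<in>ran f. abs_V t = abs_V s)"
    by (simp add: set_eq_subset image_subset_iff image_iff)
  also have "\<dots> \<longleftrightarrow> bisim (Node f) (Node g)"
    unfolding bisim_Node abs_V_eq_iff using bisim_sym by blast
  finally show ?thesis by (rule sym)
qed

lemma elts_abs: "elts (abs_V (Node f)) = abs_V ` ran f"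
proof (rule subset_antisym)
  show "abs_V ` ran f \<subseteq> elts (abs_V (Node f))"
    unfolding elts_def by blast
  show "elts (abs_V (Node f)) \<subseteq> abs_V ` ran f"
  proof
    fix y assume "y \<in> elts (abs_V (Node f))"
    then obtain g where "abs_V (Node f) = abs_V (Node g)" and y: "y \<in> abs_V ` ran g"
      unfolding elts_def mem_Collect_eq by (elim exE conjE)
    then have "abs_V ` ran f = abs_V ` ran g"
      by (simp only: abs_V_eq_iff bisim_Node_iff)
    then show "y \<in> abs_V ` ran f" using y by simp
  qed
qed

lemma V_cases: obtains f where "x = abs_V (Node f)"
proof -
  obtain f where "rep_V x = Node f" by (cases "rep_V x")
  then have "x = abs_V (Node f)" using Quotient3_abs_rep[OF Quotient3_V, of x] by simp
  then show ?thesis by (rule that)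
qed

theorem V_ext: "elts x = elts y \<Longrightarrow> x = y"
proof -
  assume eq: "elts x = elts y"
  obtain f where x: "x = abs_V (Node f)" by (rule V_cases)
  obtain g where y: "y = abs_V (Node g)" by (rule V_cases)
  have "abs_V ` ran f = abs_V ` ran g"
    using eq by (simp only: x y elts_abs)
  then show "x = y" by (simp only: x y abs_V_eq_iff bisim_Node_iff)
qed

theorem V_induct: "(\<And>x. (\<And>y. y \<in> elts x \<Longrightarrow> P y) \<Longrightarrow> P x) \<Longrightarrow> P x"
proof -
  assume step: "\<And>x. (\<And>y. y \<in> elts x \<Longrightarrow> P y) \<Longrightarrow> P x"
  have "P (abs_V t)" for t
  proof (induction t rule: wtree_induct)
    case (1 f)
    show ?case by (rule step) (use 1 in \<open>auto simp: elts_abs\<close>)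
  qed
  moreover obtain f where "x = abs_V (Node f)" by (rule V_cases)
  ultimately show "P x" by simp
qed

theorem V_wf: "wf {(y, x). y \<in> elts x}"
proof (rule wfUNIVI)
  fix P :: "'a V \<Rightarrow> bool" and x
  assume "\<forall>x. (\<forall>y. (y, x) \<in> {(y, x). y \<in> elts x} \<longrightarrow> P y) \<longrightarrow> P x"
  then show "P x" using V_induct[of P x] by simp
qed

theorem small_elts: "small (elts (x :: 'k V))"
proof -
  obtain f where x: "x = abs_V (Node f)" by (rule V_cases)
  have "elts x \<subseteq> (\<lambda>i. abs_V (the (f i))) ` UNIV"
  proof
    fix y assume "y \<in> elts x"
    then obtain t where "t \<in> ran f" "y = abs_V t" unfolding x elts_abs by blast
    then obtain i where "f i = Some t" "y = abs_V t" unfolding ran_def by blast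
    then have "y = abs_V (the (f i))" by simp
    then show "y \<in> (\<lambda>i. abs_V (the (f i))) ` UNIV" by (rule image_eqI) (rule UNIV_I)
  qed
  then show ?thesis unfolding small_def
    by (meson image_lepoll lepoll_trans subset_imp_lepoll)
qed

theorem elts_vset: "small A \<Longrightarrow> elts (vset A) = A"
proof -
  assume "small A"
  then obtain h :: "'a V \<Rightarrow> nat set + 'a" where h: "inj_on h A"
    unfolding small_def lepoll_def by blast
  define f where "f i = (if i \<in> h ` A then Some (rep_V (inv_into A h i)) else None)" for i
  have "ran f = rep_V ` A"
  proof (intro subset_antisym subsetI)
    fix t assume "t \<in> ran f"
    then obtain i where "f i = Some t" unfolding ran_def by blast
    then have "i \<in> h ` A" "t = rep_V (inv_into A h i)" by (simp_all add: f_def split: if_splits)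
    then show "t \<in> rep_V ` A" by (blast intro: inv_into_into)
  next
    fix t assume "t \<in> rep_V ` A"
    then obtain x where "x \<in> A" "t = rep_V x" by blast
    then have "f (h x) = Some t" using h by (simp add: f_def)
    then show "t \<in> ran f" by (rule ranI)
  qed
  then have "elts (abs_V (Node f)) = A"
    by (simp add: elts_abs image_image Quotient3_abs_rep[OF Quotient3_V])
  then show ?thesis unfolding vset_def by (rule someI)
qed

theorem vset_elts: "vset (elts x) = x"
  by (rule V_ext) (rule elts_vset[OF small_elts])

lemma small_countable: "countable A \<Longrightarrow> small A"
proof -
  assume "countable A"
  then obtain f :: "_ \<Rightarrow> nat" where "inj_on f A" by (auto simp: countable_def)
  then have "inj_on (\<lambda>x. Inl {f x}) A" by (auto simp: inj_on_def)
  then show ?thesis unfolding small_def lepoll_def by blast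
qed


section \<open>Ordinals, cofinality, stationary sets\<close>

text \<open>Von Neumann ordinals, ordered by membership (foundation holds by construction).\<close>

definition Ord :: "'k V \<Rightarrow> bool" where
  "Ord \<alpha> \<longleftrightarrow> (\<forall>x\<in>elts \<alpha>. elts x \<subseteq> elts \<alpha>) \<and>
    (\<forall>x\<in>elts \<alpha>. \<forall>y\<in>elts x. elts y \<subseteq> elts x)"

definition vsucc :: "'k V \<Rightarrow> 'k V" where
  "vsucc \<alpha> = vset (insert \<alpha> (elts \<alpha>))"

definition vSup :: "'k V set \<Rightarrow> 'k V" where
  "vSup A = vset (\<Union> (elts ` A))"

definition vomega :: "'k V" where
  "vomega = vset {\<alpha>. Ord \<alpha> \<and> finite (elts \<alpha>)}"

definition vomega1 :: "'k V" where
  "vomega1 = vset {\<alpha>. Ord \<alpha> \<and> countable (elts \<alpha>)}"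

text \<open>The definition of \<open>vomega1\<close> makes sense since the countable ordinals form a small set.\<close>

lemma transitive_iso_eq:
  assumes tra: "\<And>x y. x \<in> elts y \<Longrightarrow> y \<in> elts a \<Longrightarrow> x \<in> elts a"
    and trb: "\<And>x y. x \<in> elts y \<Longrightarrow> y \<in> elts b \<Longrightarrow> x \<in> elts b"
    and g: "g ` elts a = elts b"
    and mem: "\<And>x y. x \<in> elts a \<Longrightarrow> y \<in> elts a \<Longrightarrow> g x \<in> elts (g y) \<longleftrightarrow> x \<in> elts y"
  shows "a = b"
proof -
  have id: "x \<in> elts a \<longrightarrow> g x = x" for x
  proof (induction x rule: V_induct)
    case (1 x)
    show ?case
    proof (intro impI V_ext subset_antisym subsetI)
      assume x: "x \<in> elts a"
      {
        fix z assume z: "z \<in> elts (g x)"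
        have "g x \<in> elts b" using g x by blast
        then have "z \<in> elts b" using trb z by blast
        then obtain y where y: "y \<in> elts a" "z = g y" using g by blast
        then have "y \<in> elts x" using mem x z by blast
        then show "z \<in> elts x" using 1 y by simp
      next
        fix z assume z: "z \<in> elts x"
        then have "z \<in> elts a" using tra x by blast
        moreover have "g z = z" using 1 z calculation by simp
        ultimately show "z \<in> elts (g x)" using mem[of z x] x z by simp
      }
    qed
  qed
  then have "g ` elts a = elts a" by force
  then show ?thesis using g by (intro V_ext) simp
qed

lemma small_countable_ordinals: "small {\<alpha> :: 'k V. Ord \<alpha> \<and> countable (elts \<alpha>)}"
proof -
  define e :: "'k V \<Rightarrow> 'k V \<Rightarrow> nat" where "e \<alpha> = to_nat_on (elts \<alpha>)" for \<alpha>
  define c :: "'k V \<Rightarrow> nat set" where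
    "c \<alpha> = {prod_encode (0, e \<alpha> x) | x. x \<in> elts \<alpha>} \<union>
      {prod_encode (Suc (e \<alpha> x), e \<alpha> y) | x y. x \<in> elts \<alpha> \<and> y \<in> elts \<alpha> \<and> x \<in> elts y}" for \<alpha>
  have c0: "prod_encode (0, n) \<in> c \<alpha> \<longleftrightarrow> n \<in> e \<alpha> ` elts \<alpha>" for n \<alpha>
    by (auto simp: c_def)
  have c1: "prod_encode (Suc m, n) \<in> c \<alpha> \<longleftrightarrow>
      (\<exists>x y. m = e \<alpha> x \<and> n = e \<alpha> y \<and> x \<in> elts \<alpha> \<and> y \<in> elts \<alpha> \<and> x \<in> elts y)" for m n \<alpha>
    by (auto simp: c_def)
  have "inj_on c {\<alpha>. Ord \<alpha> \<and> countable (elts \<alpha>)}"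
  proof (rule inj_onI)
    fix a b :: "'k V"
    assume "a \<in> {\<alpha>. Ord \<alpha> \<and> countable (elts \<alpha>)}" "b \<in> {\<alpha>. Ord \<alpha> \<and> countable (elts \<alpha>)}"
      and eq: "c a = c b"
    then have O: "Ord a" "Ord b" and inj: "inj_on (e a) (elts a)" "inj_on (e b) (elts b)"
      by (simp_all add: e_def inj_on_to_nat_on)
    have img: "e a ` elts a = e b ` elts b"
      using c0[of _ a] c0[of _ b] eq by auto
    define g where "g = (\<lambda>x. inv_into (elts b) (e b) (e a x))"
    have gb: "g x \<in> elts b" and eg: "e b (g x) = e a x" if "x \<in> elts a" for x
    proof -
      have "e a x \<in> e b ` elts b" using img that by blast
      then show "g x \<in> elts b" "e b (g x) = e a x"
        by (simp_all add: g_def inv_into_into f_inv_into_f)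
    qed
    have rel: "y \<in> elts \<alpha> \<Longrightarrow> x \<in> elts \<alpha> \<Longrightarrow> inj_on (e \<alpha>) (elts \<alpha>) \<Longrightarrow>
        prod_encode (Suc (e \<alpha> x), e \<alpha> y) \<in> c \<alpha> \<longleftrightarrow> x \<in> elts y" for x y \<alpha>
      unfolding c1 by (auto dest: inj_onD)
    show "a = b"
    proof (rule transitive_iso_eq)
      show "\<And>x y. x \<in> elts y \<Longrightarrow> y \<in> elts a \<Longrightarrow> x \<in> elts a"
        and "\<And>x y. x \<in> elts y \<Longrightarrow> y \<in> elts b \<Longrightarrow> x \<in> elts b"
        using O by (auto simp: Ord_def)
      show "g ` elts a = elts b"
      proof
        show "g ` elts a \<subseteq> elts b" using gb by blast
        show "elts b \<subseteq> g ` elts a"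
        proof
          fix y assume y: "y \<in> elts b"
          then have "e b y \<in> e a ` elts a" using img by blast
          then obtain x where x: "x \<in> elts a" "e b y = e a x" by blast
          then have "g x = y" using inj_onD[OF inj(2), of "g x" y] gb eg y by simp
          then show "y \<in> g ` elts a" using x by blast
        qed
      qed
      show "g x \<in> elts (g y) \<longleftrightarrow> x \<in> elts y" if "x \<in> elts a" "y \<in> elts a" for x y
        using rel[of y a x] rel[of "g y" b "g x"] inj gb eg eq that by simp
    qed
  qed
  then have "inj_on (\<lambda>\<alpha>. Inl (c \<alpha>) :: nat set + 'k) {\<alpha>. Ord \<alpha> \<and> countable (elts \<alpha>)}"
    by (auto simp: inj_on_def)
  then show ?thesis unfolding small_def lepoll_def by blast
qed

lemma elts_vomega1: "elts (vomega1 :: 'k V) = {\<alpha>. Ord \<alpha> \<and> countable (elts \<alpha>)}"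
  unfolding vomega1_def by (rule elts_vset[OF small_countable_ordinals])

lemma elts_vomega: "elts (vomega :: 'k V) = {\<alpha>. Ord \<alpha> \<and> finite (elts \<alpha>)}"
proof -
  have "small {\<alpha> :: 'k V. Ord \<alpha> \<and> finite (elts \<alpha>)}"
    using small_countable_ordinals unfolding small_def
    by (rule lepoll_trans[rotated]) (auto intro!: subset_imp_lepoll countable_finite)
  then show ?thesis unfolding vomega_def by (rule elts_vset)
qed

definition Limit :: "'k V \<Rightarrow> bool" where
  "Limit \<delta> \<longleftrightarrow> Ord \<delta> \<and> elts \<delta> \<noteq> {} \<and> (\<forall>\<beta>\<in>elts \<delta>. \<exists>\<gamma>\<in>elts \<delta>. \<beta> \<in> elts \<gamma>)"

definition cofinal_in :: "'k V set \<Rightarrow> 'k V \<Rightarrow> bool" where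
  "cofinal_in B \<alpha> \<longleftrightarrow> B \<subseteq> elts \<alpha> \<and> (\<forall>\<beta>\<in>elts \<alpha>. \<exists>\<gamma>\<in>B. \<beta> = \<gamma> \<or> \<beta> \<in> elts \<gamma>)"

text \<open>The least ordinal that can be mapped cofinally into \<open>\<alpha>\<close> (the identity is such a map
  on \<open>\<alpha>\<close> itself).\<close>

definition cf :: "'k V \<Rightarrow> 'k V" where
  "cf \<alpha> = (THE \<mu>. Ord \<mu> \<and> (\<exists>f. cofinal_in (f ` elts \<mu>) \<alpha>) \<and>
    (\<forall>\<nu>\<in>elts \<mu>. \<nexists>f. cofinal_in (f ` elts \<nu>) \<alpha>))"

definition regular :: "'k V \<Rightarrow> bool" where
  "regular \<kappa> \<longleftrightarrow> Ord \<kappa> \<and> infinite (elts \<kappa>) \<and> cf \<kappa> = \<kappa>"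

text \<open>Clubs and stationary sets in a limit ordinal (used for uncountable cofinality only).\<close>

definition club_in :: "'k V set \<Rightarrow> 'k V \<Rightarrow> bool" where
  "club_in C \<rho> \<longleftrightarrow> cofinal_in C \<rho> \<and>
    (\<forall>\<delta>\<in>elts \<rho>. Limit \<delta> \<and> cofinal_in (C \<inter> elts \<delta>) \<delta> \<longrightarrow> \<delta> \<in> C)"

definition stationary_in :: "'k V set \<Rightarrow> 'k V \<Rightarrow> bool" where
  "stationary_in A \<rho> \<longleftrightarrow> A \<subseteq> elts \<rho> \<and> (\<forall>C. club_in C \<rho> \<longrightarrow> A \<inter> C \<noteq> {})"

definition cof_omega :: "'k V \<Rightarrow> 'k V set" where
  "cof_omega \<kappa> = {\<alpha> \<in> elts \<kappa>. cf \<alpha> = vomega}"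


section \<open>The sets \<open>H\<^sub>\<kappa>\<close> and the exact diagonal strong reflection principle\<close>

definition trcl :: "'k V \<Rightarrow> 'k V set" where
  "trcl x = {y. (y, x) \<in> {(u, v). u \<in> elts v}\<^sup>+}"

definition Her :: "'k V \<Rightarrow> 'k V set" where
  "Her \<kappa> = {x. trcl x \<prec> elts \<kappa>}"

definition countable_subsets :: "'k V set \<Rightarrow> 'k V set" where
  "countable_subsets Y = {x. elts x \<subseteq> Y \<and> countable (elts x)}"

definition lift :: "'k V \<Rightarrow> 'k V set \<Rightarrow> 'k V set" where
  "lift \<kappa> A = {x \<in> countable_subsets (Her \<kappa>). vSup (elts x \<inter> elts \<kappa>) \<in> A}"

definition vpair :: "'k V \<Rightarrow> 'k V \<Rightarrow> 'k V" where
  "vpair x y = vset {vset {x}, vset {x, y}}"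

text \<open>The sequence \<open>\<langle>Q\<^sub>i | i < \<alpha>\<rangle>\<close> as an element of the universe.\<close>

definition vseq :: "('k V \<Rightarrow> 'k V) \<Rightarrow> 'k V \<Rightarrow> 'k V" where
  "vseq Q \<alpha> = vset ((\<lambda>i. vpair i (Q i)) ` elts \<alpha>)"

text \<open>
  A collection \<open>\<S>\<close> of subsets of $[H_\kappa]^\omega$ is given by the extensions of its members,
  so the members of $X \cap \S$ are those \<open>S \<in> X\<close> with \<open>elts S \<in> \<S>\<close>, i.e. the elements of
  \<open>X \<inter> elts -` \<S>\<close>.
\<close>

definition exact_diagonal_chain ::
    "'k V \<Rightarrow> 'k V set set \<Rightarrow> 'k V set \<Rightarrow> ('k V \<Rightarrow> 'k V) \<Rightarrow> bool" where
  "exact_diagonal_chain \<kappa> \<S> X Q \<longleftrightarrow>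
    (\<forall>i\<in>elts vomega1. Q i \<in> countable_subsets (Her \<kappa>) \<and> Q i \<in> elts (Q (vsucc i))) \<and>
    (\<forall>l\<in>elts vomega1. Limit l \<longrightarrow> elts (Q l) = (\<Union>i\<in>elts l. elts (Q i))) \<and>
    (\<forall>S \<in> X \<inter> elts -` \<S>. stationary_in {i \<in> elts vomega1. Q i \<in> elts S} vomega1) \<and>
    Her \<kappa> \<inter> X = (\<Union>i\<in>elts vomega1. elts (Q i)) \<and>
    (\<forall>\<alpha>\<in>elts vomega1. vseq Q \<alpha> \<in> Her \<kappa> \<inter> X) \<and>
    (\<forall>i\<in>elts vomega1. \<exists>S \<in> X \<inter> elts -` \<S>. Q i \<in> elts S)"

definition stationary_in_Her :: "'k V \<Rightarrow> 'k V set set \<Rightarrow> bool" where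
  "stationary_in_Her \<theta> \<X> \<longleftrightarrow>
    (\<forall>F. (\<forall>e. finite e \<and> e \<subseteq> Her \<theta> \<longrightarrow> F e \<in> Her \<theta>) \<longrightarrow>
      (\<exists>X\<in>\<X>. \<forall>e. finite e \<and> e \<subseteq> X \<longrightarrow> F e \<in> X))"

text \<open>
  The phrase ``for a sufficiently large regular \<open>\<theta>\<close>'' is read existentially. Being large enough
  means \<open>\<S> \<subseteq> H\<^sub>\<theta>\<close> (every member of \<open>\<S>\<close> is the extension of an element of \<open>H\<^sub>\<theta>\<close>) and
  $2^{<\kappa} < \theta$; the union below has cardinality $2^{<\kappa}$ for infinite cardinals \<open>\<kappa>\<close>.
\<close>

definition eDSRP :: "'k V \<Rightarrow> 'k V set set \<Rightarrow> bool" where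
  "eDSRP \<kappa> \<S> \<longleftrightarrow>
    (\<exists>\<theta>. regular \<theta> \<and> \<S> \<subseteq> elts ` Her \<theta> \<and> (\<Union>\<mu>\<in>elts \<kappa>. Pow (elts \<mu>)) \<prec> elts \<theta> \<and>
      stationary_in_Her \<theta>
        {X. X \<subseteq> Her \<theta> \<and> X \<approx> elts (vomega1 :: 'k V) \<and> elts vomega1 \<subseteq> X \<and>
          (\<exists>Q. exact_diagonal_chain \<kappa> \<S> X Q)})"


section \<open>Reflection points\<close>

definition reflection_point :: "'k V \<Rightarrow> 'k V set \<Rightarrow> 'k V \<Rightarrow> bool" where
  "reflection_point \<kappa> A \<rho> \<longleftrightarrow>
    \<rho> \<in> elts \<kappa> \<and> vomega \<in> elts (cf \<rho>) \<and> stationary_in (A \<inter> elts \<rho>) \<rho>"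

definition exact_simultaneous_reflection_point :: "'k V \<Rightarrow> 'k V set set \<Rightarrow> 'k V \<Rightarrow> bool" where
  "exact_simultaneous_reflection_point \<kappa> \<A> \<rho> \<longleftrightarrow>
    (\<forall>A\<in>\<A>. reflection_point \<kappa> A \<rho>) \<and> (\<exists>C. club_in C \<rho> \<and> C \<subseteq> \<Union>\<A> \<inter> elts \<rho>)"

definition exact_diagonal_reflection_point ::
    "'k V \<Rightarrow> ('k V \<Rightarrow> 'k V \<Rightarrow> 'k V set) \<Rightarrow> 'k V \<Rightarrow> bool" where
  "exact_diagonal_reflection_point \<kappa> S \<rho> \<longleftrightarrow>
    \<rho> \<in> elts \<kappa> \<and> vomega \<in> elts (cf \<rho>) \<and>
    (\<exists>R \<subseteq> elts \<rho>. R \<approx> elts (vomega1 :: 'k V) \<and> (\<exists>C. club_in C \<rho> \<and> C \<subseteq> R) \<and>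
      exact_simultaneous_reflection_point \<kappa> {S \<alpha> i | \<alpha> i. \<alpha> \<in> R \<and> i \<in> elts vomega1} \<rho>)"

end

theory Submission
  imports Defs
begin

text \<open>
  Choose $X$ from the stationary set given by the reflection principle, together with an exact
  diagonal chain $Q$ up to $X$, so that $X$ is closed under four operations:
  \<open>x \<mapsto> sup (x \<inter> \<kappa>)\<close>; a function that maps every ordinal below \<open>\<kappa>\<close> to a larger one; a function
  that maps the set \<open>lift (S \<alpha> i)\<close> to an index \<open>\<alpha>\<close> for which some \<open>i\<close> yields this set; and
  \<open>(\<alpha>, i) \<mapsto> lift (S \<alpha> i)\<close>. Put \<open>R = X \<inter> \<kappa>\<close>, \<open>\<rho> = sup R\<close> and \<open>m j = sup (Q j \<inter> \<kappa>)\<close>.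
  Then \<open>\<rho> < \<kappa>\<close> since $X$ has cardinality \<open>\<omega>\<^sub>1\<close> and \<open>\<kappa> > \<omega>\<^sub>1\<close> is regular, and every \<open>m j\<close> is in \<open>R\<close>
  since \<open>Q j \<in> X\<close>.

  The chain is only required to satisfy \<open>Q j \<in> Q (j + 1)\<close>, which does not give
  \<open>Q j \<subseteq> Q (j + 1)\<close>, so the function \<open>m\<close> need not be monotone. At limits, however, \<open>Q\<close> is the union
  of everything before, so \<open>m\<close> restricted to limit ordinals is monotone and continuous, and it is
  cofinal in \<open>\<rho>\<close> as the sets \<open>Q j\<close> cover \<open>R\<close>. This is the notion \<open>continuous_cofinal\<close>, and it has
  three consequences: \<open>\<rho>\<close> has uncountable cofinality (\<open>continuous_cofinal_uncountable\<close>), the values at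
  limits form a club in \<open>\<rho>\<close> (\<open>continuous_cofinal_limit_values_club\<close>), and every club in \<open>\<rho>\<close>
  pulls back to a club in \<open>\<omega>\<^sub>1\<close> (\<open>continuous_cofinal_preimage_club\<close>).

  The rest is reading off. The club of values at limits is contained in \<open>R\<close>. By exactness of the
  chain, \<open>Q j\<close> belongs to some \<open>lift (S \<alpha> i)\<close> in $X$, where \<open>\<alpha>\<close> can be taken in \<open>R\<close>, so
  \<open>m j \<in> S \<alpha> i\<close>; hence that club is covered by the sets \<open>S \<alpha> i\<close> with \<open>\<alpha> \<in> R\<close>. Finally, for
  \<open>\<alpha> \<in> R\<close> the set \<open>lift (S \<alpha> i)\<close> is in $X$, so the \<open>j\<close> with \<open>m j \<in> S \<alpha> i\<close> are stationary
  in \<open>\<omega>\<^sub>1\<close> and meet the pullback of any given club in \<open>\<rho>\<close>.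
\<close>

section \<open>Sets of the universe\<close>

lemma mem_not_sym: "x \<in> elts y \<Longrightarrow> y \<notin> elts x"
  using wf_not_sym[OF V_wf, of x y] by simp

lemma mem_not_refl: "x \<notin> elts x"
  using mem_not_sym by blast

lemma small_subset_elts: "A \<subseteq> elts x \<Longrightarrow> small A"
  using small_elts[of x] lepoll_trans[OF subset_imp_lepoll] unfolding small_def by blast

lemma elts_vset_finite: "finite A \<Longrightarrow> elts (vset A) = A"
  by (intro elts_vset small_countable countable_finite)

lemma vpair_inject: "vpair x y = vpair x' y' \<longleftrightarrow> x = x' \<and> y = y'"
proof
  have inj: "finite A \<Longrightarrow> finite B \<Longrightarrow> vset A = vset B \<Longrightarrow> A = B" for A B :: "'a V set"
    using elts_vset_finite by metis
  assume "vpair x y = vpair x' y'"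
  then have "{vset {x}, vset {x, y}} = {vset {x'}, vset {x', y'}}"
    unfolding vpair_def by (intro inj) simp_all
  moreover have "vset {x} = vset {x'} \<longleftrightarrow> {x} = {x'}" "vset {x} = vset {x', y'} \<longleftrightarrow> {x} = {x', y'}"
    "vset {x, y} = vset {x'} \<longleftrightarrow> {x, y} = {x'}" "vset {x, y} = vset {x', y'} \<longleftrightarrow> {x, y} = {x', y'}"
    using inj[of "{x}" "{x'}"] inj[of "{x}" "{x', y'}"] inj[of "{x, y}" "{x'}"]
      inj[of "{x, y}" "{x', y'}"] by auto
  ultimately show "x = x' \<and> y = y'"
    by (auto simp: doubleton_eq_iff)
qed simp

lemma trcl_vset:
  assumes "finite A"
  shows "trcl (vset A) = A \<union> (\<Union>x\<in>A. trcl x)"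
proof (intro set_eqI iffI)
  fix y
  let ?r = "{(u, v :: 'a V). u \<in> elts v}"
  assume "y \<in> trcl (vset A)"
  then have "(y, vset A) \<in> ?r\<^sup>+" by (simp add: trcl_def)
  then show "y \<in> A \<union> (\<Union>x\<in>A. trcl x)"
    by (cases rule: tranclE) (auto simp: trcl_def elts_vset_finite[OF assms])
next
  fix y
  let ?r = "{(u, v :: 'a V). u \<in> elts v}"
  have "(x, vset A) \<in> ?r" if "x \<in> A" for x
    using that elts_vset_finite[OF assms] by simp
  moreover assume "y \<in> A \<union> (\<Union>x\<in>A. trcl x)"
  ultimately show "y \<in> trcl (vset A)"
    unfolding trcl_def by (auto intro: trancl_into_trancl)
qed

lemma lesspoll_iff_not_lepoll: "A \<prec> B \<longleftrightarrow> \<not> B \<lesssim> A"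
proof
  show "A \<prec> B \<Longrightarrow> \<not> B \<lesssim> A"
    by (auto simp: lesspoll_def intro: lepoll_antisym)
  assume "\<not> B \<lesssim> A"
  then have "(card_of A, card_of B) \<in> ordLess"
    using card_of_ordLess[of B A] by (simp add: lepoll_def)
  then have "A \<lesssim> B"
    using card_of_ordLeq[of A B] ordLess_imp_ordLeq by (auto simp: lepoll_def)
  with \<open>\<not> B \<lesssim> A\<close> show "A \<prec> B"
    using eqpoll_imp_lepoll eqpoll_sym by (auto simp: lesspoll_def)
qed

lemma Un_lesspoll_infinite:
  fixes A B :: "'b set"
  assumes "infinite C" "A \<prec> C" "B \<prec> C"
  shows "A \<union> B \<prec> C"
proof -
  have "X \<prec> C \<longleftrightarrow> (card_of X, card_of C) \<in> ordLess" for X :: "'b set"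
    using card_of_ordLess[of C X] by (simp add: lesspoll_iff_not_lepoll lepoll_def)
  then show ?thesis using assms card_of_Un_ordLess_infinite[of C A B] by blast
qed

lemma vset_in_Her:
  assumes "infinite (elts \<theta>)" "finite A" "A \<subseteq> Her \<theta>"
  shows "vset A \<in> Her \<theta>"
proof -
  have "A \<union> (\<Union>x\<in>A. trcl x) \<prec> elts \<theta>"
    using assms(2,3)
  proof (induction A)
    case empty
    show ?case using finite_lesspoll_infinite[OF assms(1), of "{}"] by simp
  next
    case (insert x A)
    have x: "trcl x \<prec> elts \<theta>" and A: "A \<union> (\<Union>y\<in>A. trcl y) \<prec> elts \<theta>"
      using insert by (auto simp: Her_def)
    have "insert x A \<union> (\<Union>y\<in>insert x A. trcl y) = {x} \<union> (trcl x \<union> (A \<union> (\<Union>y\<in>A. trcl y)))"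
      by blast
    also have "\<dots> \<prec> elts \<theta>"
      by (intro Un_lesspoll_infinite[OF assms(1)] finite_lesspoll_infinite[OF assms(1), of "{x}"] x A) simp
    finally show ?case .
  qed
  then show ?thesis by (simp add: Her_def trcl_vset[OF assms(2)])
qed


section \<open>Closure under countably many operations\<close>

text \<open>
  A function on finite sets sees neither the order nor the multiplicity of its arguments, and it has
  to simulate all operations at once. So the arguments of an operation are put into a Kuratowski
  pair \<open>z\<close>, and the number of the operation is given by the length of a chain
  \<open>z\<close>, \<open>{z}\<close>, \<open>{{z}}\<close>, \<open>\<dots>\<close> of iterated singletons.
\<close>

definition sing_iter :: "nat \<Rightarrow> 'k V \<Rightarrow> 'k V" where
  "sing_iter n z = ((\<lambda>u. vset {u}) ^^ n) z"

lemma sing_iter_simps [simp]: "sing_iter 0 z = z" "sing_iter (Suc n) z = vset {sing_iter n z}"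
  by (simp_all add: sing_iter_def)

lemma elts_sing_iter_Suc: "elts (sing_iter (Suc n) z) = {sing_iter n z}"
  by (simp add: elts_vset_finite)

lemma sing_iter_acyclic: "(z, sing_iter (Suc n) z) \<in> {(u, v). u \<in> elts v}\<^sup>+"
proof (induction n)
  case 0
  then show ?case using elts_sing_iter_Suc[of 0 z] by auto
next
  case (Suc n)
  show ?case
    by (rule trancl_into_trancl[OF Suc]) (simp add: elts_vset_finite)
qed

lemma sing_iter_not_mem: "sing_iter n z \<notin> elts z"
proof
  assume a: "sing_iter n z \<in> elts z"
  have "(z, z) \<in> {(u, v). u \<in> elts v}\<^sup>+"
  proof (cases n)
    case 0
    then show ?thesis using a by auto
  next
    case (Suc m)
    show ?thesis
      by (rule trancl_into_trancl[OF sing_iter_acyclic[of z m]]) (use a Suc in simp)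
  qed
  then show False using wf_acyclic[OF V_wf] by (auto simp: acyclic_def)
qed

lemma sing_iter_neq: "z \<noteq> sing_iter (Suc n) z"
proof
  assume "z = sing_iter (Suc n) z"
  then have "(z, z) \<in> {(u, v). u \<in> elts v}\<^sup>+" using sing_iter_acyclic[of z n] by simp
  then show False using wf_acyclic[OF V_wf] by (auto simp: acyclic_def)
qed

lemma sing_iter_inj: "inj (\<lambda>n. sing_iter n z)"
proof (rule injI)
  fix m n
  show "sing_iter m z = sing_iter n z \<Longrightarrow> m = n"
  proof (induction m arbitrary: n)
    case 0
    then show ?case using sing_iter_neq[of z "n - 1"] by (cases n) auto
  next
    case (Suc m)
    have "n \<noteq> 0"
      using Suc(2) sing_iter_neq[of z m] by (intro notI) simp
    then obtain k where n: "n = Suc k" by (cases n) auto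
    have "{sing_iter m z} = {sing_iter k z}"
      using Suc(2) elts_sing_iter_Suc unfolding n by metis
    then show ?case using Suc(1)[of k] n by simp
  qed
qed

text \<open>
  Foundation makes the coding unambiguous: \<open>z\<close> is the only member of its chain that is
  disjoint from the chain. Chains with at least three members are used for coding, while sets with
  at most two members are mapped to themselves as elements of the universe, which closes
  $X$ under pairs and hence puts all the chains into $X$.
\<close>

theorem stationary_in_Her_closed_member:
  fixes \<theta> :: "'k V"
  assumes stat: "stationary_in_Her \<theta> \<X>" and inf: "infinite (elts \<theta>)"
    and sub: "\<And>X. X \<in> \<X> \<Longrightarrow> X \<subseteq> Her \<theta>"
  shows "\<exists>X\<in>\<X>. \<forall>n::nat. \<forall>x\<in>X. \<forall>y\<in>X. g n x y \<in> Her \<theta> \<longrightarrow> g n x y \<in> X"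
proof -
  define chain where "chain n z = (\<lambda>k. sing_iter k z) ` {..<n}" for n and z :: "'k V"
  (* Outside the intended arguments F has to stay in Her theta, hence the default value {}. *)
  define F where "F e = (let w = (THE p. vpair (fst p) (snd p) \<in> e \<and>
        elts (vpair (fst p) (snd p)) \<inter> e = {});
      v = g (card e - 3) (fst w) (snd w)
    in if card e \<ge> 3 \<and> v \<in> Her \<theta> then v else if card e \<ge> 3 then vset {} else vset e)"
    for e :: "'k V set"
  have F_Her: "F e \<in> Her \<theta>" if "finite e" "e \<subseteq> Her \<theta>" for e
    using that vset_in_Her[OF inf] unfolding F_def Let_def by auto
  have F_chain: "F (chain (n + 3) (vpair x y)) = g n x y" if "g n x y \<in> Her \<theta>" for n x y
  proof -
    let ?z = "vpair x y"
    let ?e = "chain (n + 3) ?z"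
    have card: "card ?e = n + 3"
      unfolding chain_def by (subst card_image) (auto intro: inj_on_subset[OF sing_iter_inj])
    have min: "w \<in> ?e \<and> elts w \<inter> ?e = {} \<longleftrightarrow> w = ?z" for w
    proof
      assume w: "w \<in> ?e \<and> elts w \<inter> ?e = {}"
      then obtain k where k: "k < n + 3" "w = sing_iter k ?z" unfolding chain_def by blast
      show "w = ?z"
      proof (cases k)
        case 0
        then show ?thesis using k by simp
      next
        case (Suc l)
        have "sing_iter l ?z \<in> elts w" using k(2) Suc by (simp add: elts_vset_finite)
        moreover have "sing_iter l ?z \<in> ?e" using k(1) Suc by (auto simp: chain_def)
        ultimately show ?thesis using w by blast
      qed
    next
      have "?z \<in> ?e" unfolding chain_def by (rule image_eqI[of _ _ 0]) auto
      moreover assume "w = ?z"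
      ultimately show "w \<in> ?e \<and> elts w \<inter> ?e = {}"
        using sing_iter_not_mem[of _ ?z] by (auto simp: chain_def)
    qed
    have "(THE p. vpair (fst p) (snd p) \<in> ?e \<and> elts (vpair (fst p) (snd p)) \<inter> ?e = {}) = (x, y)"
      by (simp only: min vpair_inject) (rule the_equality; auto)
    then show ?thesis using that by (simp add: F_def card)
  qed
  obtain X where X: "X \<in> \<X>" and cl: "\<And>e. finite e \<Longrightarrow> e \<subseteq> X \<Longrightarrow> F e \<in> X"
    using stat[unfolded stationary_in_Her_def, rule_format, of F] F_Her by blast
  have pair: "vset {x, y} \<in> X" if "x \<in> X" "y \<in> X" for x y
  proof -
    have "card {x, y} < 3" by (simp add: card_insert_if)
    then have "F {x, y} = vset {x, y}" by (simp add: F_def)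
    then show ?thesis using cl[of "{x, y}"] that by simp
  qed
  have sing: "vset {x} \<in> X" if "x \<in> X" for x
    using pair[OF that that] by simp
  have "sing_iter k z \<in> X" if "z \<in> X" for k z
    by (induction k) (use that sing in auto)
  then have chain: "chain n z \<subseteq> X" if "z \<in> X" for n z
    using that by (auto simp: chain_def)
  have "g n x y \<in> X" if xy: "x \<in> X" "y \<in> X" and g: "g n x y \<in> Her \<theta>" for n x y
  proof -
    have "vpair x y \<in> X" unfolding vpair_def using xy by (intro pair sing)
    then have "F (chain (n + 3) (vpair x y)) \<in> X"
      by (intro cl chain) (auto simp: chain_def)
    then show ?thesis using F_chain[OF g] by simp
  qed
  then show ?thesis using X by blast
qed

section \<open>Ordinals\<close>

lemma Ord_trans: "Ord a \<Longrightarrow> x \<in> elts y \<Longrightarrow> y \<in> elts a \<Longrightarrow> x \<in> elts a"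
  by (auto simp: Ord_def)

lemma Ord_in_Ord: "Ord a \<Longrightarrow> x \<in> elts a \<Longrightarrow> Ord x"
  unfolding Ord_def by blast

text \<open>
  If neither ordinal is a member of the other then they have the same members: a member \<open>x\<close> of
  \<open>a\<close> is comparable with \<open>b\<close> by induction, and transitivity leaves only \<open>x \<in> b\<close>.
\<close>

lemma Ord_linear: "Ord a \<Longrightarrow> Ord b \<Longrightarrow> a \<in> elts b \<or> a = b \<or> b \<in> elts a"
proof (induction a arbitrary: b rule: V_induct)
  case (1 a)
  note IHa = this
  show ?case using \<open>Ord b\<close>
  proof (induction b rule: V_induct)
    case (1 b)
    show ?case
    proof (rule ccontr)
      assume no: "\<not> ?case"
      have "elts a = elts b"
      proof (intro equalityI subsetI)
        fix x assume x: "x \<in> elts a"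
        then have "x \<in> elts b \<or> x = b \<or> b \<in> elts x"
          using IHa(1)[OF x] Ord_in_Ord[OF IHa(2) x] 1(2) by blast
        then show "x \<in> elts b" using no x Ord_trans[OF IHa(2)] by blast
      next
        fix y assume y: "y \<in> elts b"
        then have "a \<in> elts y \<or> a = y \<or> y \<in> elts a"
          using 1(1)[OF y] Ord_in_Ord[OF 1(2) y] by blast
        then show "y \<in> elts a" using no y Ord_trans[OF 1(2)] by blast
      qed
      then show False using V_ext no by blast
    qed
  qed
qed

lemma Ord_mem_iff_psubset:
  assumes "Ord a" "Ord b"
  shows "a \<in> elts b \<longleftrightarrow> elts a \<subset> elts b"
proof
  assume "a \<in> elts b"
  then show "elts a \<subset> elts b" using Ord_trans[OF assms(2)] mem_not_refl by blast
next
  assume "elts a \<subset> elts b"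
  then show "a \<in> elts b" using Ord_linear[OF assms] mem_not_refl[of b] by blast
qed

lemma Ord_subset_iff:
  assumes "Ord a" "Ord b"
  shows "elts a \<subseteq> elts b \<longleftrightarrow> a = b \<or> a \<in> elts b"
  using Ord_mem_iff_psubset[OF assms] V_ext[of a b] by blast

lemma Ord_not_mem_iff: "Ord a \<Longrightarrow> Ord b \<Longrightarrow> a \<notin> elts b \<longleftrightarrow> elts b \<subseteq> elts a"
  using Ord_mem_iff_psubset[of a b] Ord_subset_iff[of b a] Ord_linear[of a b] by blast

lemma OrdI: "(\<And>x. x \<in> elts a \<Longrightarrow> Ord x \<and> elts x \<subseteq> elts a) \<Longrightarrow> Ord a"
  unfolding Ord_def by blast

lemma elts_vsucc: "elts (vsucc a) = insert a (elts a)"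
proof -
  (* Sets of the universe can be as large as this type, which is infinite and
     therefore has room for one more element. *)
  have "infinite (UNIV :: (nat set + 'a) set)"
    using finite_Plus_UNIV_iff[where 'a = "nat set" and 'b = 'a] by (simp add: Finite_Set.finite_set)
  then have "small (insert a (elts a))"
    using small_elts[of a] infinite_insert_lepoll[of "elts a" a] lepoll_trans
      finite_lepoll_infinite[of "UNIV :: (nat set + 'a) set" "insert a (elts a)"]
    unfolding small_def by (metis finite_insert)
  then show ?thesis unfolding vsucc_def by (rule elts_vset)
qed

lemma Ord_vsucc: "Ord a \<Longrightarrow> Ord (vsucc a)"
  by (rule OrdI) (auto simp: elts_vsucc dest: Ord_in_Ord Ord_trans)

lemma elts_vSup:
  assumes "Ord b" "A \<subseteq> elts b"
  shows "elts (vSup A) = (\<Union>x\<in>A. elts x)"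
  unfolding vSup_def using assms
  by (intro elts_vset small_subset_elts[of _ b]) (auto dest: Ord_trans)

lemma Ord_vSup:
  assumes "Ord b" "A \<subseteq> elts b"
  shows "Ord (vSup A)"
proof (rule OrdI)
  fix x assume "x \<in> elts (vSup A)"
  then obtain y where "y \<in> A" "x \<in> elts y" using elts_vSup[OF assms] by blast
  moreover have "Ord y" using Ord_in_Ord assms \<open>y \<in> A\<close> by blast
  ultimately show "Ord x \<and> elts x \<subseteq> elts (vSup A)"
    using elts_vSup[OF assms] Ord_in_Ord Ord_trans by blast
qed

lemma trcl_Ord:
  assumes "Ord a"
  shows "trcl a = elts a"
proof -
  have "y \<in> elts a" if "(y, a) \<in> {(u, v). u \<in> elts v}\<^sup>+" for y
    using that by (induction rule: converse_trancl_induct) (auto intro: Ord_trans[OF assms])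
  then show ?thesis by (auto simp: trcl_def)
qed

lemma Limit_Ord: "Limit a \<Longrightarrow> Ord a"
  by (simp add: Limit_def)

lemma Limit_vSup:
  assumes "Ord b" "A \<subseteq> elts b" "A \<noteq> {}" "\<And>x. x \<in> A \<Longrightarrow> \<exists>y\<in>A. x \<in> elts y"
  shows "Limit (vSup A)"
proof -
  have "\<exists>y\<in>elts (vSup A). x \<in> elts y" if x: "x \<in> elts (vSup A)" for x
    using x assms(4) elts_vSup[OF assms(1,2)] by blast
  moreover have "elts (vSup A) \<noteq> {}"
    using assms(3,4) elts_vSup[OF assms(1,2)] by blast
  ultimately show ?thesis
    using Ord_vSup[OF assms(1,2)] by (simp add: Limit_def)
qed

section \<open>Cofinality\<close>

lemma cf_properties:
  fixes a :: "'k V"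
  assumes "Ord a"
  shows "Ord (cf a)" "\<exists>f. cofinal_in (f ` elts (cf a)) a"
    "\<nu> \<in> elts (cf a) \<Longrightarrow> \<not> cofinal_in (f ` elts \<nu>) a"
proof -
  let ?P = "\<lambda>\<mu> :: 'k V. Ord \<mu> \<and> (\<exists>f. cofinal_in (f ` elts \<mu>) a)"
  have "cofinal_in ((\<lambda>x. x) ` elts a) a" by (auto simp: cofinal_in_def)
  then have "a \<in> {\<mu>. ?P \<mu>}" using assms by blast
  then obtain \<mu> where \<mu>: "\<mu> \<in> {\<mu>. ?P \<mu>}"
    and min: "\<And>\<nu>. (\<nu>, \<mu>) \<in> {(y, x). y \<in> elts x} \<Longrightarrow> \<nu> \<notin> {\<mu>. ?P \<mu>}"
    by (rule wfE_min[OF V_wf]) blast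
  have "cf a = \<mu>"
    unfolding cf_def
  proof (rule the_equality)
    show *: "Ord \<mu> \<and> (\<exists>f. cofinal_in (f ` elts \<mu>) a) \<and> (\<forall>\<nu>\<in>elts \<mu>. \<nexists>f. cofinal_in (f ` elts \<nu>) a)"
      using \<mu> min Ord_in_Ord by auto
    fix \<mu>' :: "'k V"
    assume "Ord \<mu>' \<and> (\<exists>f. cofinal_in (f ` elts \<mu>') a) \<and> (\<forall>\<nu>\<in>elts \<mu>'. \<nexists>f. cofinal_in (f ` elts \<nu>) a)"
    then show "\<mu>' = \<mu>" using * Ord_linear[of \<mu> \<mu>'] by blast
  qed
  then show "Ord (cf a)" "\<exists>f. cofinal_in (f ` elts (cf a)) a"
    "\<nu> \<in> elts (cf a) \<Longrightarrow> \<not> cofinal_in (f ` elts \<nu>) a"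
    using \<mu> min Ord_in_Ord by auto
qed


lemma countable_vomega: "countable (elts (vomega :: 'k V))"
proof -
  have "inj_on (\<lambda>a. card (elts a)) (elts (vomega :: 'k V))"
  proof (rule inj_onI)
    fix a b :: "'k V"
    assume ab: "a \<in> elts vomega" "b \<in> elts vomega" "card (elts a) = card (elts b)"
    then have "\<not> elts a \<subset> elts b" "\<not> elts b \<subset> elts a"
      using psubset_card_mono[of "elts b" "elts a"] psubset_card_mono[of "elts a" "elts b"]
      by (auto simp: elts_vomega)
    then show "a = b"
      using ab Ord_linear[of a b] Ord_mem_iff_psubset[of a b] Ord_mem_iff_psubset[of b a]
      by (auto simp: elts_vomega)
  qed
  then show ?thesis by (rule countableI')
qed

lemma Ord_vomega: "Ord (vomega :: 'k V)"
proof (rule OrdI)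
  fix x :: "'k V" assume x: "x \<in> elts vomega"
  then have "y \<in> elts vomega" if "y \<in> elts x" for y
    using that Ord_in_Ord[of x y] Ord_trans[of x _ y] finite_subset[of "elts y" "elts x"]
    by (auto simp: elts_vomega)
  then show "Ord x \<and> elts x \<subseteq> elts vomega" using x by (auto simp: elts_vomega)
qed

lemma Ord_vomega1: "Ord (vomega1 :: 'k V)"
proof (rule OrdI)
  fix x :: "'k V" assume x: "x \<in> elts vomega1"
  then have "y \<in> elts vomega1" if "y \<in> elts x" for y
    using that Ord_in_Ord[of x y] Ord_trans[of x _ y] countable_subset[of "elts y" "elts x"]
    by (auto simp: elts_vomega1)
  then show "Ord x \<and> elts x \<subseteq> elts vomega1" using x by (auto simp: elts_vomega1)
qed

lemma uncountable_cofinality: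
  assumes "Ord \<rho>" and "\<And>B. countable B \<Longrightarrow> \<not> cofinal_in B \<rho>"
  shows "vomega \<in> elts (cf \<rho>)"
proof (rule ccontr)
  assume "vomega \<notin> elts (cf \<rho>)"
  then have "elts (cf \<rho>) \<subseteq> elts vomega"
    using Ord_not_mem_iff[OF Ord_vomega cf_properties(1)[OF assms(1)]] by simp
  then have "countable (f ` elts (cf \<rho>))" for f :: "'a V \<Rightarrow> 'a V"
    using countable_subset[OF _ countable_vomega] by blast
  then show False using cf_properties(2)[OF assms(1)] assms(2) by blast
qed

lemma regular_bounded:
  assumes "regular \<kappa>" "\<nu> \<in> elts \<kappa>" "f ` elts \<nu> \<subseteq> elts \<kappa>"
  shows "\<exists>b\<in>elts \<kappa>. \<forall>x\<in>elts \<nu>. f x \<in> elts b"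
proof -
  have O: "Ord \<kappa>" and cf: "cf \<kappa> = \<kappa>" using assms(1) unfolding regular_def by blast+
  have "\<not> cofinal_in (f ` elts \<nu>) \<kappa>"
    using cf_properties(3)[OF O, of \<nu> f] assms(2) cf by simp
  then obtain b where b: "b \<in> elts \<kappa>" "\<And>x. x \<in> elts \<nu> \<Longrightarrow> b \<noteq> f x \<and> b \<notin> elts (f x)"
    using assms(3) unfolding cofinal_in_def by blast
  have "f x \<in> elts b" if "x \<in> elts \<nu>" for x
    using Ord_linear[of b "f x"] Ord_in_Ord[OF O] b that assms(3) by blast
  then show ?thesis using b(1) by blast
qed

text \<open>
  A constant function on a nonempty \<open>\<nu> < \<kappa>\<close> is not cofinal, so its value is not the maximum of \<open>\<kappa>\<close>.
\<close>

lemma regular_Limit: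
  fixes \<kappa> :: "'k V"
  assumes "regular \<kappa>"
  shows "Limit \<kappa>"
proof -
  have O: "Ord \<kappa>" and inf: "infinite (elts \<kappa>)" using assms unfolding regular_def by blast+
  have "\<exists>\<nu>\<in>elts \<kappa>. elts \<nu> \<noteq> {}"
  proof (rule ccontr)
    assume "\<not> ?thesis"
    then have "inj_on elts (elts \<kappa>)" "elts ` elts \<kappa> \<subseteq> {{}}" by (auto intro: inj_onI V_ext)
    then show False using inf finite_subset[of _ "{{}}"] finite_imageD by blast
  qed
  then obtain \<nu> x where \<nu>: "\<nu> \<in> elts \<kappa>" "x \<in> elts \<nu>" by blast
  have "\<exists>b\<in>elts \<kappa>. a \<in> elts b" if "a \<in> elts \<kappa>" for a
    using regular_bounded[OF assms \<nu>(1), of "\<lambda>_. a"] that \<nu>(2) by blast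
  then show ?thesis using O \<nu>(1) unfolding Limit_def by blast
qed

text \<open>
  Regular ordinals are cardinals, since a surjection from a smaller ordinal would be cofinal.
\<close>

lemma regular_initial:
  assumes "regular \<kappa>" "a \<in> elts \<kappa>"
  shows "elts a \<prec> elts \<kappa>"
proof (rule ccontr)
  assume "\<not> elts a \<prec> elts \<kappa>"
  then have "elts \<kappa> \<lesssim> elts a" by (simp add: lesspoll_iff_not_lepoll)
  then obtain f where f: "elts \<kappa> \<subseteq> f ` elts a" by (auto simp: lepoll_iff)
  (* f need not stay inside kappa; any element of kappa serves as default value. *)
  define h where "h x = (if f x \<in> elts \<kappa> then f x else a)" for x
  have "h ` elts a \<subseteq> elts \<kappa>" using assms(2) by (auto simp: h_def)
  then obtain b where b: "b \<in> elts \<kappa>" "\<forall>x\<in>elts a. h x \<in> elts b"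
    using regular_bounded[OF assms] by blast
  then obtain x where "x \<in> elts a" "f x = b" using f by blast
  then show False using b mem_not_refl[of b] by (auto simp: h_def)
qed

lemma regular_subset_Her: "regular \<kappa> \<Longrightarrow> elts \<kappa> \<subseteq> Her \<kappa>"
  using regular_initial trcl_Ord Ord_in_Ord by (fastforce simp: Her_def regular_def)

section \<open>Countable ordinals\<close>

lemma vomega1_bounded:
  assumes "countable B" "B \<subseteq> elts vomega1"
  shows "vSup B \<in> elts vomega1"
proof -
  have "countable (\<Union>x\<in>B. elts x)"
    using assms by (intro countable_UN) (auto simp: elts_vomega1)
  then show ?thesis
    using elts_vSup[OF Ord_vomega1 assms(2)] Ord_vSup[OF Ord_vomega1 assms(2)]
    by (simp add: elts_vomega1)
qed

lemma vsucc_in_vomega1: "i \<in> elts vomega1 \<Longrightarrow> vsucc i \<in> elts vomega1"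
  by (auto simp: elts_vomega1 Ord_vsucc elts_vsucc)

lemma vomega1_limit_of_sequence:
  fixes j :: "nat \<Rightarrow> 'k V"
  assumes "\<And>n. j n \<in> elts vomega1" "\<And>n. j n \<in> elts (j (Suc n))"
  shows "vSup (range j) \<in> elts vomega1" "Limit (vSup (range j))"
    "elts (vSup (range j)) = (\<Union>n. elts (j n))" 
proof -
  have sub: "range j \<subseteq> elts vomega1" using assms(1) by blast
  show "vSup (range j) \<in> elts vomega1" by (rule vomega1_bounded) (use sub in auto)
  show "Limit (vSup (range j))" by (rule Limit_vSup[OF Ord_vomega1 sub]) (use assms(2) in auto)
  show "elts (vSup (range j)) = (\<Union>n. elts (j n))" using elts_vSup[OF Ord_vomega1 sub] by simp
qed

lemma vomega1_limit_above:
  assumes "countable B" "B \<subseteq> elts vomega1"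
  obtains l where "l \<in> elts vomega1" "Limit l" "B \<subseteq> elts l"
proof -
  define j where "j n = (vsucc ^^ n) (vsucc (vSup B))" for n
  have j0: "j 0 = vsucc (vSup B)" and jS: "j (Suc n) = vsucc (j n)" for n
    by (simp_all add: j_def)
  have j: "j n \<in> elts vomega1" for n
    by (induction n) (use vomega1_bounded[OF assms] in \<open>auto simp: j0 jS intro: vsucc_in_vomega1\<close>)
  have jj: "j n \<in> elts (j (Suc n))" for n by (simp add: jS elts_vsucc)
  note lim = vomega1_limit_of_sequence[of j, OF j jj]
  have "B \<subseteq> elts (j 0)"
  proof
    fix x assume "x \<in> B"
    moreover have "Ord x" using \<open>x \<in> B\<close> assms(2) by (auto simp: elts_vomega1)
    moreover have "elts x \<subseteq> elts (vSup B)"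
      using \<open>x \<in> B\<close> elts_vSup[OF Ord_vomega1 assms(2)] by blast
    ultimately show "x \<in> elts (j 0)"
      using Ord_subset_iff[of x "vSup B"] Ord_vSup[OF Ord_vomega1 assms(2)]
      by (auto simp: j0 elts_vsucc)
  qed
  then have "B \<subseteq> elts (vSup (range j))" unfolding lim(3) by blast
  then show thesis using lim(1,2) that by blast
qed

section \<open>Continuous \<open>\<omega>\<^sub>1\<close>-sequences\<close>

text \<open>
  Monotonicity and continuity are only demanded at limits, where both are contained in the
  union condition; the values at other ordinals may jump back and forth.
\<close>

definition continuous_cofinal :: "('k V \<Rightarrow> 'k V) \<Rightarrow> 'k V \<Rightarrow> bool" where
  "continuous_cofinal m \<rho> \<longleftrightarrow> Ord \<rho> \<and> (\<forall>j\<in>elts vomega1. m j \<in> elts \<rho>) \<and>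
    (\<forall>l\<in>elts vomega1. Limit l \<longrightarrow> elts (m l) = (\<Union>i\<in>elts l. elts (m i))) \<and>
    (\<forall>\<beta>\<in>elts \<rho>. \<exists>j\<in>elts vomega1. \<beta> \<in> elts (m j))"

context
  fixes m :: "'k V \<Rightarrow> 'k V" and \<rho> :: "'k V"
  assumes m: "continuous_cofinal m \<rho>"
begin

lemma continuous_cofinal_Ord: "Ord \<rho>" 
  using m by (simp add: continuous_cofinal_def)

lemma continuous_cofinal_mem: "j \<in> elts vomega1 \<Longrightarrow> m j \<in> elts \<rho>"
  using m by (simp add: continuous_cofinal_def)

lemma continuous_cofinal_limit: "l \<in> elts vomega1 \<Longrightarrow> Limit l \<Longrightarrow> elts (m l) = (\<Union>i\<in>elts l. elts (m i))"
  using m by (simp add: continuous_cofinal_def)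

lemma continuous_cofinal_above: "\<beta> \<in> elts \<rho> \<Longrightarrow> \<exists>j\<in>elts vomega1. \<beta> \<in> elts (m j)"
  using m by (simp add: continuous_cofinal_def)

lemma continuous_cofinal_value_Ord: "j \<in> elts vomega1 \<Longrightarrow> Ord (m j)"
  using Ord_in_Ord[OF continuous_cofinal_Ord continuous_cofinal_mem] .

text \<open>
  All upper bounds can be chosen at limits, since countably many countable ordinals lie below a
  countable limit ordinal.
\<close>

lemma continuous_cofinal_bound:
  assumes "countable B" "B \<subseteq> elts \<rho>" "countable J" "J \<subseteq> elts vomega1"
  obtains l where "l \<in> elts vomega1" "Limit l" "B \<subseteq> elts (m l)" "J \<subseteq> elts l"
proof -
  obtain k where k: "\<And>\<beta>. \<beta> \<in> B \<Longrightarrow> k \<beta> \<in> elts vomega1 \<and> \<beta> \<in> elts (m (k \<beta>))"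
    using continuous_cofinal_above assms(2) by (metis subsetD)
  have "countable (k ` B \<union> J)" using assms(1,3) by simp
  moreover have "k ` B \<union> J \<subseteq> elts vomega1" using k assms(4) by auto
  ultimately obtain l where l: "l \<in> elts vomega1" "Limit l" "k ` B \<union> J \<subseteq> elts l"
    by (rule vomega1_limit_above)
  have "B \<subseteq> elts (m l)"
  proof
    fix \<beta> assume "\<beta> \<in> B"
    then show "\<beta> \<in> elts (m l)" using k[of \<beta>] l(3) continuous_cofinal_limit[OF l(1,2)] by blast
  qed
  then show thesis using that[of l] l by simp
qed

lemma continuous_cofinal_uncountable: "vomega \<in> elts (cf \<rho>)"
proof (rule uncountable_cofinality[OF continuous_cofinal_Ord])
  fix B :: "'k V set"
  assume B: "countable B"
  show "\<not> cofinal_in B \<rho>"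
  proof
    assume c: "cofinal_in B \<rho>"
    then have "B \<subseteq> elts \<rho>" by (simp add: cofinal_in_def)
    then obtain l where l: "l \<in> elts vomega1" "B \<subseteq> elts (m l)"
      using continuous_cofinal_bound[OF B _ countable_empty empty_subsetI] by blast
    obtain \<gamma> where "\<gamma> \<in> B" "m l = \<gamma> \<or> m l \<in> elts \<gamma>"
      using c continuous_cofinal_mem[OF l(1)] unfolding cofinal_in_def by blast
    then show False using l(2) mem_not_refl mem_not_sym by blast
  qed
qed

text \<open>
  For a limit \<open>\<delta>\<close> of such values, let \<open>L\<close> be the set of limit ordinals whose value is below \<open>\<delta>\<close>. It is
  bounded, as the values eventually exceed \<open>\<delta>\<close>, and has no maximum, as \<open>\<delta>\<close> is a limit of values.
  So \<open>sup L\<close> is a countable limit ordinal, at which continuity gives the value \<open>\<delta>\<close>.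
\<close>

lemma continuous_cofinal_limit_values_club:
  "club_in {m l | l. l \<in> elts vomega1 \<and> Limit l} \<rho>" (is "club_in ?C \<rho>")
  unfolding club_in_def
proof (intro conjI ballI impI)
  show "cofinal_in ?C \<rho>"
    unfolding cofinal_in_def
  proof (intro conjI ballI)
    show "?C \<subseteq> elts \<rho>" using continuous_cofinal_mem by blast
    fix \<beta> assume "\<beta> \<in> elts \<rho>"
    then obtain l where "l \<in> elts vomega1" "Limit l" "\<beta> \<in> elts (m l)"
      using continuous_cofinal_bound[of "{\<beta>}" "{}"] by auto
    then show "\<exists>\<gamma>\<in>?C. \<beta> = \<gamma> \<or> \<beta> \<in> elts \<gamma>" by blast
  qed
next
  fix \<delta> assume \<delta>: "\<delta> \<in> elts \<rho>" and "Limit \<delta> \<and> cofinal_in (?C \<inter> elts \<delta>) \<delta>"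
  then have lim: "Limit \<delta>" and cof: "cofinal_in (?C \<inter> elts \<delta>) \<delta>" by auto
  have Od: "Ord \<delta>" using lim by (rule Limit_Ord)
  define L where "L = {l \<in> elts vomega1. Limit l \<and> m l \<in> elts \<delta>}"
  have L_sub: "L \<subseteq> elts vomega1" by (auto simp: L_def)
  have above: "\<exists>l\<in>L. \<beta> \<in> elts (m l)" if \<beta>: "\<beta> \<in> elts \<delta>" for \<beta>
  proof -
    obtain \<gamma> where g: "\<gamma> \<in> elts \<delta>" "\<beta> \<in> elts \<gamma>" using lim \<beta> unfolding Limit_def by blast
    then obtain l where l: "l \<in> L" "\<gamma> = m l \<or> \<gamma> \<in> elts (m l)"
      using cof by (auto simp: cofinal_in_def L_def)
    moreover have "Ord (m l)" using l L_sub continuous_cofinal_value_Ord by blast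
    ultimately show ?thesis using g Ord_trans by blast
  qed
  have mono: "elts (m i) \<subseteq> elts (m l)" if "l \<in> L" "i \<in> elts l" for i l
    using that continuous_cofinal_limit[of l] by (auto simp: L_def)
  have step: "\<exists>l'\<in>L. l \<in> elts l'" if l: "l \<in> L" for l
  proof -
    obtain l' where l': "l' \<in> L" "m l \<in> elts (m l')" using above l by (auto simp: L_def)
    have "\<not> elts (m l') \<subseteq> elts (m l)" using l' mem_not_refl by blast
    then have "l' \<noteq> l" "l' \<notin> elts l" using mono[OF l] by auto
    then show ?thesis using Ord_linear[of l l'] l l' by (auto simp: L_def Limit_Ord)
  qed
  have "L \<noteq> {}" using above lim by (auto simp: Limit_def)
  then have Lim: "Limit (vSup L)" using step by (intro Limit_vSup[OF Ord_vomega1 L_sub])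
  obtain k where k: "k \<in> elts vomega1" "\<delta> \<in> elts (m k)" using continuous_cofinal_above[OF \<delta>] by blast
  have "L \<subseteq> insert k (elts k)"
  proof
    fix l assume l: "l \<in> L"
    have "k \<notin> elts l"
    proof
      assume "k \<in> elts l"
      then have "\<delta> \<in> elts (m l)" using mono[OF l] k by blast
      then show False using l mem_not_sym by (auto simp: L_def)
    qed
    then show "l \<in> insert k (elts k)"
      using Ord_linear[of k l] l k by (auto simp: L_def elts_vomega1)
  qed
  then have "countable L" using k(1) by (auto simp: elts_vomega1 intro: countable_subset)
  then have in1: "vSup L \<in> elts vomega1" using vomega1_bounded L_sub by blast
  have "elts (m (vSup L)) = elts \<delta>"
    unfolding continuous_cofinal_limit[OF in1 Lim]
  proof (intro equalityI subsetI)
    fix \<beta> assume "\<beta> \<in> (\<Union>i\<in>elts (vSup L). elts (m i))"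
    then obtain l i where "l \<in> L" "i \<in> elts l" "\<beta> \<in> elts (m i)"
      using elts_vSup[OF Ord_vomega1 L_sub] by blast
    then have "\<beta> \<in> elts (m l)" "m l \<in> elts \<delta>" using mono by (auto simp: L_def)
    then show "\<beta> \<in> elts \<delta>" using Ord_trans[OF Od] by blast
  next
    fix \<beta> assume "\<beta> \<in> elts \<delta>"
    then obtain l l' where "l \<in> L" "\<beta> \<in> elts (m l)" "l' \<in> L" "l \<in> elts l'"
      using above step by meson
    then show "\<beta> \<in> (\<Union>i\<in>elts (vSup L). elts (m i))"
      using elts_vSup[OF Ord_vomega1 L_sub] by blast
  qed
  then show "\<delta> \<in> ?C" using V_ext in1 Lim by blast
qed

text \<open>
  Unboundedness is the usual interleaving: limit ordinals $j_0 < j_1 < \dots$ and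
  $c_n \in C$ are chosen with $m(j_n) \le c_n < m(j_{n+1})$, so that at the supremum of the $j_n$
  the value of \<open>m\<close> is the supremum of the $c_n$, which is in \<open>C\<close>.
\<close>

lemma continuous_cofinal_preimage_club:
  assumes C: "club_in C \<rho>"
  shows "club_in {l \<in> elts vomega1. Limit l \<and> m l \<in> C} vomega1" (is "club_in ?D vomega1")
proof -
  have C_cof: "\<exists>\<gamma>\<in>C. \<beta> = \<gamma> \<or> \<beta> \<in> elts \<gamma>" if "\<beta> \<in> elts \<rho>" for \<beta>
    using C that unfolding club_in_def cofinal_in_def by blast
  have C_sub: "C \<subseteq> elts \<rho>"
    using C unfolding club_in_def cofinal_in_def by blast
  have C_lim: "m l \<in> C" if l: "l \<in> elts vomega1" and ne: "elts (m l) \<noteq> {}"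
    and c: "\<And>\<beta>. \<beta> \<in> elts (m l) \<Longrightarrow> \<exists>\<gamma>\<in>C \<inter> elts (m l). \<beta> \<in> elts \<gamma>" for l
  proof -
    have "Limit (m l)" using continuous_cofinal_value_Ord[OF l] ne c by (auto simp: Limit_def)
    moreover have "cofinal_in (C \<inter> elts (m l)) (m l)" using c by (auto simp: cofinal_in_def)
    ultimately show ?thesis using C continuous_cofinal_mem[OF l] unfolding club_in_def by blast
  qed
  have cofinal: "\<exists>l\<in>?D. j0 \<in> elts l" if j0: "j0 \<in> elts vomega1" for j0
  proof -
    have step: "\<exists>j'. (j' \<in> elts vomega1 \<and> Limit j') \<and> 
        j \<in> elts j' \<and> (\<exists>c\<in>C. elts (m j) \<subseteq> elts c \<and> c \<in> elts (m j'))"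
      if j: "j \<in> elts vomega1 \<and> Limit j" for j
    proof -
      obtain c where c: "c \<in> C" "m j = c \<or> m j \<in> elts c" using C_cof[OF continuous_cofinal_mem] j by blast
      have "Ord c" using c C_sub Ord_in_Ord[OF continuous_cofinal_Ord] by blast
      then have "elts (m j) \<subseteq> elts c" using c Ord_trans by blast
      moreover obtain j' where "j' \<in> elts vomega1" "Limit j'" "{c} \<subseteq> elts (m j')" "{j} \<subseteq> elts j'"
        using continuous_cofinal_bound[of "{c}" "{j}"] c(1) C_sub j by auto
      ultimately show ?thesis using c by blast
    qed
    obtain k0 where k0: "k0 \<in> elts vomega1" "Limit k0" "{j0} \<subseteq> elts k0"
      using vomega1_limit_above[of "{j0}"] j0 by auto
    have "\<exists>j. \<forall>n. ((j n \<in> elts vomega1 \<and> Limit (j n)) \<and> (n = 0 \<longrightarrow> j n = k0)) \<and>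
        j n \<in> elts (j (Suc n)) \<and> (\<exists>c\<in>C. elts (m (j n)) \<subseteq> elts c \<and> c \<in> elts (m (j (Suc n))))"
      by (rule dependent_nat_choice) (use k0 step in auto)
    then obtain j where j: "j 0 = k0" "\<And>n. j n \<in> elts vomega1 \<and> Limit (j n)"
      "\<And>n. j n \<in> elts (j (Suc n)) \<and> (\<exists>c\<in>C. elts (m (j n)) \<subseteq> elts c \<and> c \<in> elts (m (j (Suc n))))"
      by blast
    define l where "l = vSup (range j)"
    have l: "l \<in> elts vomega1" "Limit l" "elts l = (\<Union>n. elts (j n))"
      unfolding l_def by (rule vomega1_limit_of_sequence; use j in simp)+
    have ml: "elts (m l) = (\<Union>n. elts (m (j n)))"
    proof (intro equalityI subsetI)
      fix \<beta> assume "\<beta> \<in> elts (m l)"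
      then obtain i n where "\<beta> \<in> elts (m i)" "i \<in> elts (j n)"
        using continuous_cofinal_limit[OF l(1,2)] l(3) by blast
      then show "\<beta> \<in> (\<Union>n. elts (m (j n)))"
        using continuous_cofinal_limit[of "j n"] j(2)[of n] by blast
    next
      fix \<beta> assume "\<beta> \<in> (\<Union>n. elts (m (j n)))"
      then obtain n where "\<beta> \<in> elts (m (j n))" by blast
      moreover have "j n \<in> elts l" using j(3) l(3) by blast
      ultimately show "\<beta> \<in> elts (m l)" using continuous_cofinal_limit[OF l(1,2)] by blast
    qed
    have "m l \<in> C"
    proof (rule C_lim[OF l(1)])
      show "elts (m l) \<noteq> {}" using j(3)[of 0] unfolding ml by blast
      show "\<exists>\<gamma>\<in>C \<inter> elts (m l). \<beta> \<in> elts \<gamma>" if "\<beta> \<in> elts (m l)" for \<beta>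
        using that j(3) unfolding ml by blast
    qed
    moreover have "j0 \<in> elts l" using k0(3) j(1) l(3) by blast
    ultimately show ?thesis using l by blast
  qed
  have closed: "\<delta> \<in> ?D"
    if \<delta>: "\<delta> \<in> elts vomega1" and lim: "Limit \<delta>" and cof: "cofinal_in (?D \<inter> elts \<delta>) \<delta>" for \<delta>
    (* m may be constant below delta from some point on, and then m delta need not
       be a limit of members of C but is itself one of the values in C. *)
  proof (cases "\<exists>l\<in>?D \<inter> elts \<delta>. m l = m \<delta>")
    case True
    then show ?thesis using \<delta> lim by auto
  next
    case False
    have up: "m l \<in> C \<inter> elts (m \<delta>)" if l: "l \<in> ?D \<inter> elts \<delta>" for l
    proof -
      have "elts (m l) \<subseteq> elts (m \<delta>)" using l continuous_cofinal_limit[OF \<delta> lim] by blast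
      then show ?thesis using False l Ord_subset_iff[of "m l" "m \<delta>"] continuous_cofinal_value_Ord \<delta> by auto
    qed
    have "m \<delta> \<in> C"
    proof (rule C_lim[OF \<delta>])
      show "elts (m \<delta>) \<noteq> {}"
        using up cof lim unfolding cofinal_in_def Limit_def by blast
      fix \<beta> assume "\<beta> \<in> elts (m \<delta>)"
      then obtain i where i: "i \<in> elts \<delta>" "\<beta> \<in> elts (m i)" using continuous_cofinal_limit[OF \<delta> lim] by blast
      then obtain l where l: "l \<in> ?D \<inter> elts \<delta>" "i = l \<or> i \<in> elts l"
        using cof unfolding cofinal_in_def by blast
      then have "\<beta> \<in> elts (m l)" using i continuous_cofinal_limit[of l] by blast
      then show "\<exists>\<gamma>\<in>C \<inter> elts (m \<delta>). \<beta> \<in> elts \<gamma>" using up[OF l(1)] by blast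
    qed
    then show ?thesis using \<delta> lim by blast
  qed
  show ?thesis
    unfolding club_in_def
  proof (intro conjI ballI impI)
    show "cofinal_in ?D vomega1" unfolding cofinal_in_def using cofinal by blast
  qed (use closed in blast)
qed

end

section \<open>Exact diagonal reflection\<close>

theorem theorem6p15:
  fixes \<kappa> :: "'k V" and S :: "'k V \<Rightarrow> 'k V \<Rightarrow> 'k V set"
  assumes "regular \<kappa>" and "vomega1 \<in> elts \<kappa>"
    and "\<And>\<alpha> i. \<alpha> \<in> elts \<kappa> \<Longrightarrow> i \<in> elts vomega1 \<Longrightarrow>
      S \<alpha> i \<subseteq> cof_omega \<kappa> \<and> stationary_in (S \<alpha> i) \<kappa>"
    and "eDSRP \<kappa> {lift \<kappa> (S \<alpha> i) | \<alpha> i. \<alpha> \<in> elts \<kappa> \<and> i \<in> elts vomega1}"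
  shows "\<exists>\<rho>. exact_diagonal_reflection_point \<kappa> S \<rho>"
proof -
  define \<S> where "\<S> = {lift \<kappa> (S \<alpha> i) | \<alpha> i. \<alpha> \<in> elts \<kappa> \<and> i \<in> elts vomega1}"
  have O: "Ord \<kappa>" using assms(1) by (simp add: regular_def)
  have vomega1_sub: "elts vomega1 \<subseteq> elts \<kappa>" using Ord_trans[OF O _ assms(2)] by blast
  obtain \<theta> where \<theta>: "regular \<theta>" "\<S> \<subseteq> elts ` Her \<theta>" "(\<Union>\<mu>\<in>elts \<kappa>. Pow (elts \<mu>)) \<prec> elts \<theta>"
    and stat: "stationary_in_Her \<theta> {X. X \<subseteq> Her \<theta> \<and> X \<approx> elts (vomega1 :: 'k V) \<and>
      elts vomega1 \<subseteq> X \<and> (\<exists>Q. exact_diagonal_chain \<kappa> \<S> X Q)}"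
    using assms(4) unfolding eDSRP_def \<S>_def by blast
  have inf\<theta>: "infinite (elts \<theta>)" using \<theta>(1) by (simp add: regular_def)
  (* An ordinal below kappa has fewer than theta members, because its members are also
     subsets of it and so are counted in the union of the power sets. *)
  have \<kappa>_Her: "elts \<kappa> \<subseteq> Her \<theta>"
  proof
    fix \<alpha> assume \<alpha>: "\<alpha> \<in> elts \<kappa>"
    have "elts \<alpha> \<subseteq> elts \<kappa>" using Ord_trans[OF O] \<alpha> by blast
    then have "elts ` elts \<alpha> \<subseteq> (\<Union>\<mu>\<in>elts \<kappa>. Pow (elts \<mu>))" by blast
    moreover have "inj_on elts (elts \<alpha>)" by (intro inj_onI V_ext)
    ultimately have "elts \<alpha> \<lesssim> (\<Union>\<mu>\<in>elts \<kappa>. Pow (elts \<mu>))"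
      unfolding lepoll_def by blast
    then have "elts \<alpha> \<prec> elts \<theta>" using \<theta>(3) by (rule lesspoll_trans1)
    then show "\<alpha> \<in> Her \<theta>"
      using trcl_Ord[OF Ord_in_Ord[OF O \<alpha>]] by (simp add: Her_def)
  qed
  have code: "vset A \<in> Her \<theta> \<and> elts (vset A) = A" if "A \<in> \<S>" for A
  proof -
    obtain s where "s \<in> Her \<theta>" "A = elts s" using \<theta>(2) \<open>A \<in> \<S>\<close> by blast
    then show ?thesis by (simp add: vset_elts)
  qed

  define index where "index s = (SOME \<alpha>. \<alpha> \<in> elts \<kappa> \<and> (\<exists>i\<in>elts vomega1. elts s = lift \<kappa> (S \<alpha> i)))" for s
  define above where "above \<alpha> = (SOME \<beta>. \<beta> \<in> elts \<kappa> \<and> \<alpha> \<in> elts \<beta>)" for \<alpha>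
  define g where "g n x y = (if n = (0::nat) then vSup (elts x \<inter> elts \<kappa>) else if n = 1 then above x
    else if n = 2 then index x else vset (lift \<kappa> (S x y)))" for n x y
  have "\<exists>X\<in>{X. X \<subseteq> Her \<theta> \<and> X \<approx> elts (vomega1 :: 'k V) \<and> elts vomega1 \<subseteq> X \<and>
      (\<exists>Q. exact_diagonal_chain \<kappa> \<S> X Q)}.
      \<forall>n. \<forall>x\<in>X. \<forall>y\<in>X. g n x y \<in> Her \<theta> \<longrightarrow> g n x y \<in> X"
    by (rule stationary_in_Her_closed_member[OF stat inf\<theta>]) simp
  then obtain X Q where X: "X \<subseteq> Her \<theta>" "X \<approx> elts (vomega1 :: 'k V)" "elts vomega1 \<subseteq> X"
    and Q: "exact_diagonal_chain \<kappa> \<S> X Q"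
    and closed: "\<And>n x y. x \<in> X \<Longrightarrow> y \<in> X \<Longrightarrow> g n x y \<in> Her \<theta> \<Longrightarrow> g n x y \<in> X"
    by blast
  define m where "m j = vSup (elts (Q j) \<inter> elts \<kappa>)" for j
  define R where "R = X \<inter> elts \<kappa>"
  define \<rho> where "\<rho> = vSup R"

  have above: "\<exists>\<beta>\<in>R. \<alpha> \<in> elts \<beta>" if "\<alpha> \<in> R" for \<alpha>
  proof -
    have "above \<alpha> \<in> elts \<kappa> \<and> \<alpha> \<in> elts (above \<alpha>)"
      unfolding above_def
      by (rule someI_ex) (use regular_Limit[OF assms(1)] that in \<open>auto simp: Limit_def R_def\<close>)
    moreover from this have "above \<alpha> \<in> X"
      using closed[of \<alpha> \<alpha> 1] that \<kappa>_Her by (auto simp: g_def R_def)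
    ultimately show ?thesis by (auto simp: R_def)
  qed
  have index: "\<exists>\<alpha>\<in>R. \<exists>i\<in>elts vomega1. elts s = lift \<kappa> (S \<alpha> i)" if "s \<in> X" "elts s \<in> \<S>" for s
  proof -
    have "index s \<in> elts \<kappa> \<and> (\<exists>i\<in>elts vomega1. elts s = lift \<kappa> (S (index s) i))"
      unfolding index_def by (rule someI_ex) (use that(2) in \<open>auto simp: \<S>_def\<close>)
    moreover from this have "index s \<in> X"
      using closed[of s s 2] that(1) \<kappa>_Her by (auto simp: g_def)
    ultimately show ?thesis by (auto simp: R_def)
  qed
  have lift_in: "vset (lift \<kappa> (S \<alpha> i)) \<in> X \<inter> elts -` \<S>" "elts (vset (lift \<kappa> (S \<alpha> i))) = lift \<kappa> (S \<alpha> i)"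
    if "\<alpha> \<in> R" "i \<in> elts vomega1" for \<alpha> i
  proof -
    have mem: "lift \<kappa> (S \<alpha> i) \<in> \<S>" using that by (auto simp: \<S>_def R_def)
    show "elts (vset (lift \<kappa> (S \<alpha> i))) = lift \<kappa> (S \<alpha> i)" using code[OF mem] by blast
    moreover have "g 3 \<alpha> i \<in> X"
      by (rule closed) (use that X(3) code[OF mem] in \<open>auto simp: g_def R_def\<close>)
    ultimately show "vset (lift \<kappa> (S \<alpha> i)) \<in> X \<inter> elts -` \<S>" using mem by (simp add: g_def)
  qed

  have Q_chain: "Q i \<in> elts (Q (vsucc i))" if "i \<in> elts vomega1" for i
    using Q that unfolding exact_diagonal_chain_def by blast
  have Q_limit: "elts (Q l) = (\<Union>i\<in>elts l. elts (Q i))" if "l \<in> elts vomega1" "Limit l" for l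
    using Q that unfolding exact_diagonal_chain_def by blast
  have Q_stat: "stationary_in {i \<in> elts vomega1. Q i \<in> elts s} vomega1" if "s \<in> X \<inter> elts -` \<S>" for s
    using Q that unfolding exact_diagonal_chain_def by blast
  have Q_union: "Her \<kappa> \<inter> X = (\<Union>i\<in>elts vomega1. elts (Q i))"
    using Q unfolding exact_diagonal_chain_def by blast
  have Q_exact: "\<exists>s \<in> X \<inter> elts -` \<S>. Q i \<in> elts s" if "i \<in> elts vomega1" for i
    using Q that unfolding exact_diagonal_chain_def by blast

  have m_exact: "\<exists>\<alpha>\<in>R. \<exists>i\<in>elts vomega1. m j \<in> S \<alpha> i" if j: "j \<in> elts vomega1" for j
  proof -
    obtain s where s: "s \<in> X" "elts s \<in> \<S>" "Q j \<in> elts s" using Q_exact[OF j] by blast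
    then obtain \<alpha> i where "\<alpha> \<in> R" "i \<in> elts vomega1" "elts s = lift \<kappa> (S \<alpha> i)"
      using index by blast
    then show ?thesis using s(3) by (auto simp: lift_def m_def)
  qed
  have m_R: "m j \<in> R" if j: "j \<in> elts vomega1" for j
  proof -
    have \<kappa>: "m j \<in> elts \<kappa>"
      using m_exact[OF j] assms(3) unfolding R_def cof_omega_def by blast
    have "Q j \<in> X" using Q_chain[OF j] vsucc_in_vomega1[OF j] Q_union by blast
    then have "g 0 (Q j) (Q j) \<in> X"
      by (intro closed) (use \<kappa> \<kappa>_Her in \<open>auto simp: g_def m_def\<close>)
    then show ?thesis using \<kappa> by (simp add: g_def m_def R_def)
  qed
  have R_\<kappa>: "R \<subseteq> elts \<kappa>" by (simp add: R_def)
  have elts_\<rho>: "elts \<rho> = (\<Union>\<alpha>\<in>R. elts \<alpha>)" unfolding \<rho>_def by (rule elts_vSup[OF O R_\<kappa>])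
  have R_\<rho>: "R \<subseteq> elts \<rho>" using above elts_\<rho> by blast
  have cc: "continuous_cofinal m \<rho>"
    unfolding continuous_cofinal_def
  proof (intro conjI ballI impI)
    show "Ord \<rho>" unfolding \<rho>_def by (rule Ord_vSup[OF O R_\<kappa>])
    show "m j \<in> elts \<rho>" if "j \<in> elts vomega1" for j using m_R[OF that] R_\<rho> by blast
    have elts_m: "elts (m j) = (\<Union>\<alpha>\<in>elts (Q j) \<inter> elts \<kappa>. elts \<alpha>)" for j
      unfolding m_def by (rule elts_vSup[OF O]) blast
    show "elts (m l) = (\<Union>i\<in>elts l. elts (m i))" if "l \<in> elts vomega1" "Limit l" for l
      unfolding elts_m Q_limit[OF that] by blast
    fix \<beta> assume "\<beta> \<in> elts \<rho>"
    then obtain \<gamma> where \<gamma>: "\<gamma> \<in> R" "\<beta> \<in> elts \<gamma>" using elts_\<rho> by blast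
    then have "\<gamma> \<in> Her \<kappa> \<inter> X" "\<gamma> \<in> elts \<kappa>" using regular_subset_Her[OF assms(1)] by (auto simp: R_def)
    then show "\<exists>j\<in>elts vomega1. \<beta> \<in> elts (m j)" using Q_union \<gamma>(2) unfolding elts_m by blast
  qed
  have \<rho>_\<kappa>: "\<rho> \<in> elts \<kappa>"
  proof -
    have "X \<lesssim> elts (vomega1 :: 'k V)" using X(2) by (rule eqpoll_imp_lepoll)
    then obtain h where h: "X \<subseteq> h ` elts (vomega1 :: 'k V)" by (auto simp: lepoll_iff)
    (* X may have elements that are not ordinals below kappa; vomega1 stands in for them. *)
    define f where "f i = (if h i \<in> elts \<kappa> then h i else vomega1)" for i
    have "f ` elts vomega1 \<subseteq> elts \<kappa>" using assms(2) by (auto simp: f_def)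
    then obtain b where b: "b \<in> elts \<kappa>" "\<forall>i\<in>elts vomega1. f i \<in> elts b"
      using regular_bounded[OF assms(1,2)] by blast
    have Ob: "Ord b" by (rule Ord_in_Ord[OF O b(1)])
    have "R \<subseteq> elts b"
    proof
      fix \<alpha> assume "\<alpha> \<in> R"
      then obtain i where "i \<in> elts vomega1" "h i = \<alpha>" using h by (auto simp: R_def)
      then show "\<alpha> \<in> elts b" using b(2) \<open>\<alpha> \<in> R\<close> by (force simp: f_def R_def)
    qed
    then have "elts \<rho> \<subseteq> elts b" unfolding elts_\<rho> using Ord_trans[OF Ob] by blast
    then show ?thesis
      using Ord_subset_iff[OF continuous_cofinal_Ord[OF cc] Ob] b(1) Ord_trans[OF O _ b(1)] by blast
  qed
  have R_card: "R \<approx> elts (vomega1 :: 'k V)"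
  proof (rule lepoll_antisym)
    show "R \<lesssim> elts (vomega1 :: 'k V)"
      by (rule lepoll_trans2[OF subset_imp_lepoll X(2)]) (simp add: R_def)
    show "elts (vomega1 :: 'k V) \<lesssim> R"
      using X(3) vomega1_sub by (intro subset_imp_lepoll) (simp add: R_def)
  qed
  have cof: "vomega \<in> elts (cf \<rho>)" by (rule continuous_cofinal_uncountable[OF cc])
  have refl: "reflection_point \<kappa> (S \<alpha> i) \<rho>" if \<alpha>i: "\<alpha> \<in> R" "i \<in> elts vomega1" for \<alpha> i
  proof -
    have "S \<alpha> i \<inter> elts \<rho> \<inter> C \<noteq> {}" if C: "club_in C \<rho>" for C
    proof -
      have "\<exists>l. l \<in> elts vomega1 \<and> Q l \<in> lift \<kappa> (S \<alpha> i) \<and> m l \<in> C"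
        using Q_stat[OF lift_in(1)[OF \<alpha>i]] continuous_cofinal_preimage_club[OF cc C] lift_in(2)[OF \<alpha>i]
        unfolding stationary_in_def by blast
      then obtain l where "l \<in> elts vomega1" "m l \<in> S \<alpha> i" "m l \<in> C"
        by (auto simp: lift_def m_def)
      then show ?thesis using continuous_cofinal_mem[OF cc] by blast
    qed
    then show ?thesis using \<rho>_\<kappa> cof unfolding reflection_point_def stationary_in_def by blast
  qed
  define C where "C = {m l | l. l \<in> elts vomega1 \<and> Limit l}"
  define \<A> where "\<A> = {S \<alpha> i | \<alpha> i. \<alpha> \<in> R \<and> i \<in> elts vomega1}"
  have club: "club_in C \<rho>" unfolding C_def by (rule continuous_cofinal_limit_values_club[OF cc])
  have C_R: "C \<subseteq> R" unfolding C_def using m_R by blast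
  have "C \<subseteq> \<Union>\<A>"
  proof
    fix \<gamma> assume "\<gamma> \<in> C"
    then obtain l where "l \<in> elts vomega1" "\<gamma> = m l" unfolding C_def by blast
    then obtain \<alpha> i where "\<alpha> \<in> R" "i \<in> elts vomega1" "\<gamma> \<in> S \<alpha> i" using m_exact by blast
    then show "\<gamma> \<in> \<Union>\<A>" unfolding \<A>_def by blast
  qed
  then have "\<exists>C. club_in C \<rho> \<and> C \<subseteq> \<Union>\<A> \<inter> elts \<rho>" using club C_R R_\<rho> by blast
  moreover have "\<forall>A\<in>\<A>. reflection_point \<kappa> A \<rho>" unfolding \<A>_def using refl by blast
  ultimately have "exact_simultaneous_reflection_point \<kappa> \<A> \<rho>"
    by (simp add: exact_simultaneous_reflection_point_def)
  then have "R \<subseteq> elts \<rho> \<and> R \<approx> elts (vomega1 :: 'k V) \<and> (\<exists>C. club_in C \<rho> \<and> C \<subseteq> R) \<and>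
      exact_simultaneous_reflection_point \<kappa> {S \<alpha> i | \<alpha> i. \<alpha> \<in> R \<and> i \<in> elts vomega1} \<rho>"
    using R_\<rho> R_card club C_R unfolding \<A>_def by blast
  then have "exact_diagonal_reflection_point \<kappa> S \<rho>"
    unfolding exact_diagonal_reflection_point_def using \<rho>_\<kappa> cof by blast
  then show ?thesis by blast
qed

end
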